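(* In the internal logic of $\mathcal{S}$: $\forall\,\kappa:\mathbb{K}.\ \forall\,\phi:\Omega.\ \phi\Rightarrow\triangleright^{\kappa}\phi$.
   Context: Let $\mathbb{F}^+$ be the category whose objects are $\bullet^n$ for $n>0$ (free category with strictly associative binary products on one object); a morphism $\bullet^n\to\bullet^m$ is equivalently a function $\{0,\dots,m-1\}\to\{0,\dots,n-1\}$. Let $\mathcal{N}=\mathrm{Hom}_{\mathbb{F}^+}(-,\bullet^1)$. For $U\in\mathbb{F}^+$ let $\mathrm{CLK}[U]=\omega^{\mathcal{N}(U)}$ ordered pointwise, with $\mathrm{CLK}[f](\partial_V)=(\kappa\mapsto\partial_V(f^*\kappa))$ for $f:V\to U$. The category $\mathbb{CLK}$ has objects $\mathbf{U}=(U,\partial_U)$ and morphisms $f:(V,\partial_V)\to(U,\partial_U)$ the $\mathbb{F}^+$-maps $f:V\to U$ with $\mathrm{CLK}[f](\partial_V)\le\partial_U$. $\mathcal{S}$ is the presheaf topos on $\mathbb{CLK}$, with clock object $\mathbb{K}(U,\partial_U)=\mathcal{N}(U)$ and subobject classifier $\Omega$. Write $\mathbf{U}[\kappa\mapsto n]$ for $(U,\partial_U[\kappa\mapsto n])$ and $[\kappa\mathrel{+}=1]:\mathbf{U}\to\mathbf{U}[\kappa\mapsto\partial_U(\kappa)+1]$ for the morphism with identity underlying map. The later modality is defined by forcing: $\mathbf{U}\Vdash\triangleright^{\kappa}\phi(\alpha)$ iff $\partial_U(\kappa)=0$, or $\partial_U(\kappa)=n+1$ and $\mathbf{U}[\kappa\mapsto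 n]\Vdash\phi([\kappa\mathrel{+}=1]^*\alpha)$. Other connectives are interpreted by standard Kripke–Joyal semantics. *)

theory Defs
  imports Main "HOL-Library.FuncSet"
begin

section \<open>Categories and presheaves\<close>

datatype ('o, 'm) arrow = Arrow (src: 'o) (tgt: 'o) (umap: 'm)

record ('o, 'm) category =
  Obj :: "'o set"
  Hom :: "'o \<Rightarrow> 'o \<Rightarrow> ('o, 'm) arrow set"
  Ident :: "'o \<Rightarrow> ('o, 'm) arrow"
  Comp :: "('o, 'm) arrow \<Rightarrow> ('o, 'm) arrow \<Rightarrow> ('o, 'm) arrow"

text \<open>Composition is written in the applicative order: \<open>Comp C g f\<close> is \<open>g \<circ> f\<close>.\<close>

definition is_category :: "('o, 'm) category \<Rightarrow> bool" where
  "is_category C \<longleftrightarrow>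
     (\<forall>V U. \<forall>f \<in> Hom C V U. V \<in> Obj C \<and> U \<in> Obj C \<and> src f = V \<and> tgt f = U) \<and>
     (\<forall>U \<in> Obj C. Ident C U \<in> Hom C U U) \<and>
     (\<forall>W V U. \<forall>f \<in> Hom C V U. \<forall>g \<in> Hom C W V. Comp C f g \<in> Hom C W U) \<and>
     (\<forall>V U. \<forall>f \<in> Hom C V U. Comp C f (Ident C V) = f \<and> Comp C (Ident C U) f = f) \<and>
     (\<forall>X W V U. \<forall>f \<in> Hom C V U. \<forall>g \<in> Hom C W V. \<forall>h \<in> Hom C X W.
        Comp C (Comp C f g) h = Comp C f (Comp C g h))"

text \<open>For \<open>f : V \<rightarrow> U\<close>, the reindexing map \<open>f\<^sup>* : P(U) \<rightarrow> P(V)\<close> is \<open>restr P f\<close>.\<close>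

record ('o, 'm, 'x) presheaf =
  sect :: "'o \<Rightarrow> 'x set"
  restr :: "('o, 'm) arrow \<Rightarrow> 'x \<Rightarrow> 'x"

definition is_presheaf :: "('o, 'm) category \<Rightarrow> ('o, 'm, 'x) presheaf \<Rightarrow> bool" where
  "is_presheaf C P \<longleftrightarrow>
     (\<forall>V U. \<forall>f \<in> Hom C V U. \<forall>x \<in> sect P U. restr P f x \<in> sect P V) \<and>
     (\<forall>U \<in> Obj C. \<forall>x \<in> sect P U. restr P (Ident C U) x = x) \<and>
     (\<forall>W V U. \<forall>f \<in> Hom C V U. \<forall>g \<in> Hom C W V. \<forall>x \<in> sect P U.
        restr P (Comp C f g) x = restr P g (restr P f x))"

definition representable :: "('o, 'm) category \<Rightarrow> 'o \<Rightarrow> ('o, 'm, ('o, 'm) arrow) presheaf" where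
  "representable C X = \<lparr>sect = (\<lambda>U. Hom C U X), restr = (\<lambda>f x. Comp C x f)\<rparr>"

definition terminal_psh :: "('o, 'm, unit) presheaf" where
  "terminal_psh = \<lparr>sect = (\<lambda>_. UNIV), restr = (\<lambda>_ x. x)\<rparr>"

definition prod_psh ::
    "('o, 'm, 'x) presheaf \<Rightarrow> ('o, 'm, 'y) presheaf \<Rightarrow> ('o, 'm, 'x \<times> 'y) presheaf"
    (infixl \<open>\<times>\<^sub>P\<close> 70) where
  "P \<times>\<^sub>P Q = \<lparr>sect = (\<lambda>U. sect P U \<times> sect Q U), restr = (\<lambda>f. map_prod (restr P f) (restr Q f))\<rparr>"

definition maximal_sieve :: "('o, 'm) category \<Rightarrow> 'o \<Rightarrow> ('o, 'm) arrow set" where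
  "maximal_sieve C U = (\<Union>V. Hom C V U)"

definition is_sieve :: "('o, 'm) category \<Rightarrow> 'o \<Rightarrow> ('o, 'm) arrow set \<Rightarrow> bool" where
  "is_sieve C U S \<longleftrightarrow> S \<subseteq> maximal_sieve C U \<and>
     (\<forall>f \<in> S. \<forall>W. \<forall>g \<in> Hom C W (src f). Comp C f g \<in> S)"

text \<open>The subobject classifier of the presheaf topos.\<close>

definition Omega :: "('o, 'm) category \<Rightarrow> ('o, 'm, ('o, 'm) arrow set) presheaf" where
  "Omega C = \<lparr>sect = (\<lambda>U. {S. is_sieve C U S}),
              restr = (\<lambda>f S. {g \<in> maximal_sieve C (src f). Comp C f g \<in> S})\<rparr>"

section \<open>Kripke--Joyal semantics\<close>

text \<open>
  A formula in context \<open>\<Gamma>\<close>, where \<open>\<Gamma>\<close> is a presheaf, is given by its forcing relation: \<open>\<phi> U \<alpha>\<close> stands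
  for \<open>U \<tturnstile> \<phi>(\<alpha>)\<close> with \<open>\<alpha> \<in> \<Gamma>(U)\<close>.  A term in context \<open>\<Gamma>\<close> of sort \<open>X\<close> is given by the components
  \<open>t U : \<Gamma>(U) \<rightarrow> X(U)\<close> of a natural transformation.  Quantifying over a variable of sort \<open>X\<close>
  extends the context to \<open>\<Gamma> \<times>\<^sub>P X\<close>.
\<close>

type_synonym ('o, 'g) formula = "'o \<Rightarrow> 'g \<Rightarrow> bool"
type_synonym ('o, 'g, 'x) trm = "'o \<Rightarrow> 'g \<Rightarrow> 'x"

text \<open>A term \<open>t\<close> of sort \<open>\<Omega>\<close> regarded as a formula: it is forced where \<open>t\<close> factors through \<open>true\<close>.\<close>

definition kj_holds :: "('o, 'm) category \<Rightarrow> ('o, 'g, ('o, 'm) arrow set) trm \<Rightarrow> ('o, 'g) formula" where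
  "kj_holds C t U \<alpha> \<longleftrightarrow> t U \<alpha> = maximal_sieve C U"

definition kj_imp ::
    "('o, 'm) category \<Rightarrow> ('o, 'm, 'g) presheaf \<Rightarrow> ('o, 'g) formula \<Rightarrow> ('o, 'g) formula \<Rightarrow> ('o, 'g) formula" where
  "kj_imp C \<Gamma> \<phi> \<psi> U \<alpha> \<longleftrightarrow>
     (\<forall>V. \<forall>f \<in> Hom C V U. \<phi> V (restr \<Gamma> f \<alpha>) \<longrightarrow> \<psi> V (restr \<Gamma> f \<alpha>))"

definition kj_all ::
    "('o, 'm) category \<Rightarrow> ('o, 'm, 'g) presheaf \<Rightarrow> ('o, 'm, 'x) presheaf \<Rightarrow>
     ('o, 'g \<times> 'x) formula \<Rightarrow> ('o, 'g) formula" where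
  "kj_all C \<Gamma> X \<psi> U \<alpha> \<longleftrightarrow>
     (\<forall>V. \<forall>f \<in> Hom C V U. \<forall>x \<in> sect X V. \<psi> V (restr \<Gamma> f \<alpha>, x))"

definition kj_valid :: "('o, 'm) category \<Rightarrow> ('o, unit) formula \<Rightarrow> bool" where
  "kj_valid C \<phi> \<longleftrightarrow> (\<forall>U \<in> Obj C. \<phi> U ())"

definition is_formula :: "('o, 'm) category \<Rightarrow> ('o, 'm, 'g) presheaf \<Rightarrow> ('o, 'g) formula \<Rightarrow> bool" where
  "is_formula C \<Gamma> \<phi> \<longleftrightarrow>
     (\<forall>V U. \<forall>f \<in> Hom C V U. \<forall>\<alpha> \<in> sect \<Gamma> U. \<phi> U \<alpha> \<longrightarrow> \<phi> V (restr \<Gamma> f \<alpha>))"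

definition is_term ::
    "('o, 'm) category \<Rightarrow> ('o, 'm, 'g) presheaf \<Rightarrow> ('o, 'm, 'x) presheaf \<Rightarrow> ('o, 'g, 'x) trm \<Rightarrow> bool" where
  "is_term C \<Gamma> X t \<longleftrightarrow>
     (\<forall>U \<in> Obj C. \<forall>\<alpha> \<in> sect \<Gamma> U. t U \<alpha> \<in> sect X U) \<and>
     (\<forall>V U. \<forall>f \<in> Hom C V U. \<forall>\<alpha> \<in> sect \<Gamma> U. t V (restr \<Gamma> f \<alpha>) = restr X f (t U \<alpha>))"

section \<open>The category of clocks\<close>

text \<open>
  The object \<open>\<bullet>\<^sup>n\<close> is represented by \<open>n > 0\<close>, and a morphism from \<open>n\<close> to \<open>m\<close> by a function
  \<open>{0,\<dots>,m-1} \<rightarrow> {0,\<dots>,n-1}\<close>, in the opposite direction.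
\<close>

definition Fplus :: "(nat, nat \<Rightarrow> nat) category" where
  "Fplus = \<lparr>Obj = {n. n > 0},
            Hom = (\<lambda>n m. {Arrow n m h | h. n > 0 \<and> m > 0 \<and> h \<in> {..<m} \<rightarrow>\<^sub>E {..<n}}),
            Ident = (\<lambda>n. Arrow n n (\<lambda>i\<in>{..<n}. i)),
            Comp = (\<lambda>g f. Arrow (src f) (tgt g) (compose {..<tgt g} (umap f) (umap g)))\<rparr>"

type_synonym fobj = nat
type_synonym farr = "(nat, nat \<Rightarrow> nat) arrow"

definition Names :: "(fobj, nat \<Rightarrow> nat, farr) presheaf" where
  "Names = representable Fplus 1"

definition Clk :: "fobj \<Rightarrow> (farr \<Rightarrow> nat) set" where
  "Clk U = (sect Names U \<rightarrow>\<^sub>E UNIV)"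

definition Clk_map :: "farr \<Rightarrow> (farr \<Rightarrow> nat) \<Rightarrow> (farr \<Rightarrow> nat)" where
  "Clk_map f d = (\<lambda>\<kappa>\<in>sect Names (tgt f). d (restr Names f \<kappa>))"

definition Clk_le :: "fobj \<Rightarrow> (farr \<Rightarrow> nat) \<Rightarrow> (farr \<Rightarrow> nat) \<Rightarrow> bool" where
  "Clk_le U d e \<longleftrightarrow> (\<forall>\<kappa> \<in> sect Names U. d \<kappa> \<le> e \<kappa>)"

type_synonym cobj = "fobj \<times> (farr \<Rightarrow> nat)"
type_synonym carr = "(cobj, farr) arrow"

definition CLK :: "(cobj, farr) category" where
  "CLK = \<lparr>Obj = (SIGMA U : Obj Fplus. Clk U),
          Hom = (\<lambda>(V, dV) (U, dU). {Arrow (V, dV) (U, dU) f | f.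
                   dV \<in> Clk V \<and> dU \<in> Clk U \<and> f \<in> Hom Fplus V U \<and> Clk_le U (Clk_map f dV) dU}),
          Ident = (\<lambda>(U, dU). Arrow (U, dU) (U, dU) (Ident Fplus U)),
          Comp = (\<lambda>g f. Arrow (src f) (tgt g) (Comp Fplus (umap g) (umap f)))\<rparr>"

definition Clocks :: "(cobj, farr, farr) presheaf" where
  "Clocks = \<lparr>sect = (\<lambda>(U, dU). sect Names U), restr = (\<lambda>f. restr Names (umap f))\<rparr>"

definition clk_upd :: "cobj \<Rightarrow> farr \<Rightarrow> nat \<Rightarrow> cobj" where
  "clk_upd U \<kappa> n = (fst U, (snd U)(\<kappa> := n))"

text \<open>The morphism \<open>[\<kappa> += 1] : U \<rightarrow> U[\<kappa> \<mapsto> \<partial>\<^sub>U(\<kappa>) + 1]\<close>.\<close>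

definition tick :: "cobj \<Rightarrow> farr \<Rightarrow> carr" where
  "tick U \<kappa> = Arrow U (clk_upd U \<kappa> (snd U \<kappa> + 1)) (Ident Fplus (fst U))"

text \<open>
  If \<open>\<partial>\<^sub>U(\<kappa>) = n + 1\<close> then \<open>U[\<kappa> \<mapsto> n][\<kappa> \<mapsto> n + 1] = U\<close>, so \<open>\<alpha> \<in> \<Gamma>(U)\<close> is reindexed along
  \<open>[\<kappa> += 1] : U[\<kappa> \<mapsto> n] \<rightarrow> U\<close>.
\<close>

definition later ::
    "(cobj, farr, 'g) presheaf \<Rightarrow> (cobj, 'g, farr) trm \<Rightarrow> (cobj, 'g) formula \<Rightarrow> (cobj, 'g) formula" where
  "later \<Gamma> k \<phi> U \<alpha> \<longleftrightarrow>
     (let \<kappa> = k U \<alpha> in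
        snd U \<kappa> = 0 \<or>
        (\<exists>n. snd U \<kappa> = n + 1 \<and> \<phi> (clk_upd U \<kappa> n) (restr \<Gamma> (tick (clk_upd U \<kappa> n) \<kappa>) \<alpha>)))"

section \<open>Well-definedness\<close>

lemma is_category_Fplus: "is_category Fplus"
  unfolding is_category_def
proof (intro conjI)
  show "\<forall>X W V U. \<forall>f\<in>Hom Fplus V U. \<forall>g\<in>Hom Fplus W V. \<forall>h\<in>Hom Fplus X W.
        Comp Fplus (Comp Fplus f g) h = Comp Fplus f (Comp Fplus g h)"
    by (auto simp: Fplus_def compose_def PiE_def Pi_def fun_eq_iff)
  show "\<forall>V U. \<forall>f\<in>Hom Fplus V U. Comp Fplus f (Ident Fplus V) = f \<and> Comp Fplus (Ident Fplus U) f = f"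
    by (auto simp: Fplus_def compose_def PiE_def Pi_def fun_eq_iff extensional_def)
  show "\<forall>W V U. \<forall>f\<in>Hom Fplus V U. \<forall>g\<in>Hom Fplus W V. Comp Fplus f g \<in> Hom Fplus W U"
    by (auto simp: Fplus_def compose_def PiE_def Pi_def)
  show "\<forall>U\<in>Obj Fplus. Ident Fplus U \<in> Hom Fplus U U"
    by (auto simp: Fplus_def PiE_def Pi_def)
  show "\<forall>V U. \<forall>f\<in>Hom Fplus V U. V \<in> Obj Fplus \<and> U \<in> Obj Fplus \<and> src f = V \<and> tgt f = U"
  proof (intro allI ballI)
    fix V U f assume "f \<in> Hom Fplus V U"
    then obtain h where "f = Arrow V U h" "V > 0" "U > 0" unfolding Fplus_def by auto
    then show "V \<in> Obj Fplus \<and> U \<in> Obj Fplus \<and> src f = V \<and> tgt f = U"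
      by (simp add: Fplus_def)
  qed
qed

lemma catD:
  assumes "is_category C"
  shows "f \<in> Hom C V U \<Longrightarrow> V \<in> Obj C" "f \<in> Hom C V U \<Longrightarrow> U \<in> Obj C"
    "f \<in> Hom C V U \<Longrightarrow> src f = V" "f \<in> Hom C V U \<Longrightarrow> tgt f = U"
    "U \<in> Obj C \<Longrightarrow> Ident C U \<in> Hom C U U"
    "f \<in> Hom C V U \<Longrightarrow> g \<in> Hom C W V \<Longrightarrow> Comp C f g \<in> Hom C W U"
    "f \<in> Hom C V U \<Longrightarrow> Comp C f (Ident C V) = f"
    "f \<in> Hom C V U \<Longrightarrow> Comp C (Ident C U) f = f"
    "f \<in> Hom C V U \<Longrightarrow> g \<in> Hom C W V \<Longrightarrow> h \<in> Hom C X W \<Longrightarrow>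
       Comp C (Comp C f g) h = Comp C f (Comp C g h)"
  using assms unfolding is_category_def by blast+

lemma pshD:
  assumes "is_presheaf C P"
  shows "f \<in> Hom C V U \<Longrightarrow> x \<in> sect P U \<Longrightarrow> restr P f x \<in> sect P V"
    "U \<in> Obj C \<Longrightarrow> x \<in> sect P U \<Longrightarrow> restr P (Ident C U) x = x"
    "f \<in> Hom C V U \<Longrightarrow> g \<in> Hom C W V \<Longrightarrow> x \<in> sect P U \<Longrightarrow>
       restr P (Comp C f g) x = restr P g (restr P f x)"
  using assms unfolding is_presheaf_def by blast+

lemma is_presheaf_representable: "is_category C \<Longrightarrow> is_presheaf C (representable C X)"
  using catD(6,7,9)[of C] unfolding is_presheaf_def representable_def
  by (intro conjI allI ballI; simp)

lemma is_presheaf_terminal: "is_presheaf C terminal_psh"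
  unfolding is_presheaf_def terminal_psh_def by simp

lemma is_presheaf_prod: "is_presheaf C P \<Longrightarrow> is_presheaf C Q \<Longrightarrow> is_presheaf C (P \<times>\<^sub>P Q)"
  unfolding is_presheaf_def prod_psh_def by simp

lemma is_presheaf_Omega:
  assumes C: "is_category C"
  shows "is_presheaf C (Omega C)"
  unfolding is_presheaf_def
proof (intro conjI allI ballI)
  fix V U f S assume f: "f \<in> Hom C V U" and S: "S \<in> sect (Omega C) U"
  show "restr (Omega C) f S \<in> sect (Omega C) V"
    unfolding Omega_def is_sieve_def
  proof (simp add: catD(3)[OF C f], intro conjI allI impI ballI)
    fix g W h assume g: "g \<in> maximal_sieve C V \<and> Comp C f g \<in> S" and h: "h \<in> Hom C W (src g)"
    then obtain W' where g': "g \<in> Hom C W' V" by (auto simp: maximal_sieve_def)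
    then have h': "h \<in> Hom C W W'" using h catD(3)[OF C] by metis
    show "Comp C g h \<in> maximal_sieve C V"
      using catD(6)[OF C g' h'] by (auto simp: maximal_sieve_def)
    have "h \<in> Hom C W (src (Comp C f g))"
      using catD(3)[OF C catD(6)[OF C f g']] h' by simp
    then have "Comp C (Comp C f g) h \<in> S"
      using S g by (simp add: Omega_def is_sieve_def)
    then show "Comp C f (Comp C g h) \<in> S"
      using catD(9)[OF C f g' h'] by simp
  qed
next
  fix U S assume U: "U \<in> Obj C" and S: "S \<in> sect (Omega C) U"
  have "src (Ident C U) = U" using catD(3)[OF C catD(5)[OF C U]] .
  moreover have "g \<in> maximal_sieve C U \<and> Comp C (Ident C U) g \<in> S \<longleftrightarrow> g \<in> S" for g
  proof -
    have "Comp C (Ident C U) g = g" if "g \<in> maximal_sieve C U"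
      using that catD(8)[OF C] by (auto simp: maximal_sieve_def)
    moreover have "S \<subseteq> maximal_sieve C U" using S by (simp add: Omega_def is_sieve_def)
    ultimately show ?thesis by auto
  qed
  ultimately show "restr (Omega C) (Ident C U) S = S"
    by (simp add: Omega_def)
next
  fix W V U f g S
  assume f: "f \<in> Hom C V U" and g: "g \<in> Hom C W V" and S: "S \<in> sect (Omega C) U"
  have [simp]: "src f = V" "src g = W" "src (Comp C f g) = W"
    using catD(3)[OF C f] catD(3)[OF C g] catD(3)[OF C catD(6)[OF C f g]] .
  have "Comp C (Comp C f g) h = Comp C f (Comp C g h)" "Comp C g h \<in> maximal_sieve C V"
    if "h \<in> maximal_sieve C W" for h
    using that catD(9)[OF C f g] catD(6)[OF C g] unfolding maximal_sieve_def by blast+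
  then show "restr (Omega C) (Comp C f g) S = restr (Omega C) g (restr (Omega C) f S)"
    by (auto simp: Omega_def)
qed

lemma is_presheaf_Names: "is_presheaf Fplus Names"
  unfolding Names_def by (rule is_presheaf_representable[OF is_category_Fplus])

lemma CLK_HomI:
  "f \<in> Hom Fplus (fst V) (fst U) \<Longrightarrow> snd V \<in> Clk (fst V) \<Longrightarrow> snd U \<in> Clk (fst U) \<Longrightarrow>
   (\<And>\<kappa>. \<kappa> \<in> sect Names (fst U) \<Longrightarrow> snd V (restr Names f \<kappa>) \<le> snd U \<kappa>) \<Longrightarrow>
   Arrow V U f \<in> Hom CLK V U"
  by (cases V; cases U) (auto simp: CLK_def Clk_le_def Clk_map_def catD(4)[OF is_category_Fplus])

lemma CLK_HomE:
  assumes "f \<in> Hom CLK V U"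
  shows "f = Arrow V U (umap f)" "umap f \<in> Hom Fplus (fst V) (fst U)"
    "snd V \<in> Clk (fst V)" "snd U \<in> Clk (fst U)"
    "\<kappa> \<in> sect Names (fst U) \<Longrightarrow> snd V (restr Names (umap f) \<kappa>) \<le> snd U \<kappa>"
proof -
  obtain g where g: "f = Arrow V U g" "g \<in> Hom Fplus (fst V) (fst U)" "snd V \<in> Clk (fst V)"
    "snd U \<in> Clk (fst U)" "Clk_le (fst U) (Clk_map g (snd V)) (snd U)"
    using assms by (cases V; cases U) (auto simp: CLK_def)
  then show "f = Arrow V U (umap f)" "umap f \<in> Hom Fplus (fst V) (fst U)"
    "snd V \<in> Clk (fst V)" "snd U \<in> Clk (fst U)" by simp_all
  show "snd V (restr Names (umap f) \<kappa>) \<le> snd U \<kappa>" if "\<kappa> \<in> sect Names (fst U)"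
    using g(1,5) that catD(4)[OF is_category_Fplus g(2)] by (simp add: Clk_le_def Clk_map_def)
qed

lemma is_category_CLK: "is_category CLK"
proof -
  note F = catD[OF is_category_Fplus]
  have comp: "Comp CLK f g = Arrow (src g) (tgt f) (Comp Fplus (umap f) (umap g))" for f g
    by (simp add: CLK_def)
  have id: "Ident CLK U = Arrow U U (Ident Fplus (fst U))" for U
    by (cases U) (simp add: CLK_def)
  have st: "src f = V" "tgt f = U" if "f \<in> Hom CLK V U" for f V U
    using CLK_HomE(1)[OF that] by (metis arrow.sel)+
  have ob: "U \<in> Obj CLK \<longleftrightarrow> fst U \<in> Obj Fplus \<and> snd U \<in> Clk (fst U)" for U
    by (cases U) (simp add: CLK_def)
  show ?thesis
    unfolding is_category_def
  proof (intro conjI allI ballI)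
    fix V U f assume f: "f \<in> Hom CLK V U"
    note e = CLK_HomE[OF f]
    show "V \<in> Obj CLK" "U \<in> Obj CLK" using e F by (auto simp: ob)
    show "src f = V" "tgt f = U" using st f by auto
    show "Comp CLK f (Ident CLK V) = f" "Comp CLK (Ident CLK U) f = f"
      using st[OF f] F(7)[OF e(2)] F(8)[OF e(2)] e(1) by (simp_all add: comp id)
  next
    fix U assume "U \<in> Obj CLK"
    then show "Ident CLK U \<in> Hom CLK U U"
      unfolding id ob by (intro CLK_HomI) (auto simp: F pshD(2)[OF is_presheaf_Names])
  next
    fix W V U f g assume f: "f \<in> Hom CLK V U" and g: "g \<in> Hom CLK W V"
    note e = CLK_HomE[OF f] and d = CLK_HomE[OF g]
    show "Comp CLK f g \<in> Hom CLK W U"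
      unfolding comp st[OF f] st[OF g]
    proof (intro CLK_HomI F(6)[OF e(2) d(2)] e d)
      fix \<kappa> assume k: "\<kappa> \<in> sect Names (fst U)"
      show "snd W (restr Names (Comp Fplus (umap f) (umap g)) \<kappa>) \<le> snd U \<kappa>"
        using pshD(3)[OF is_presheaf_Names e(2) d(2) k]
          d(5)[OF pshD(1)[OF is_presheaf_Names e(2) k]] e(5)[OF k] by simp
    qed
  next
    fix X W V U f g h
    assume f: "f \<in> Hom CLK V U" and g: "g \<in> Hom CLK W V" and h: "h \<in> Hom CLK X W"
    show "Comp CLK (Comp CLK f g) h = Comp CLK f (Comp CLK g h)"
      using F(9)[OF CLK_HomE(2)[OF f] CLK_HomE(2)[OF g] CLK_HomE(2)[OF h]] by (simp add: comp)
  qed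
qed

lemma is_presheaf_Clocks: "is_presheaf CLK Clocks"
  unfolding is_presheaf_def
proof (intro conjI allI ballI)
  fix V U f x assume "f \<in> Hom CLK V U" "x \<in> sect Clocks U"
  then show "restr Clocks f x \<in> sect Clocks V"
    using pshD(1)[OF is_presheaf_Names CLK_HomE(2)] by (auto simp: Clocks_def split_beta)
next
  fix U x assume "U \<in> Obj CLK" "x \<in> sect Clocks U"
  then show "restr Clocks (Ident CLK U) x = x"
    using pshD(2)[OF is_presheaf_Names] by (auto simp: Clocks_def CLK_def split_beta)
next
  fix W V U f g x
  assume f: "f \<in> Hom CLK V U" and g: "g \<in> Hom CLK W V" and x: "x \<in> sect Clocks U"
  have "umap (Comp CLK f g) = Comp Fplus (umap f) (umap g)"
    by (simp add: CLK_def)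
  then show "restr Clocks (Comp CLK f g) x = restr Clocks g (restr Clocks f x)"
    using pshD(3)[OF is_presheaf_Names CLK_HomE(2)[OF f] CLK_HomE(2)[OF g]] x
    by (auto simp: Clocks_def split_beta)
qed

lemma clk_upd_Clk:
  "snd U \<in> Clk (fst U) \<Longrightarrow> \<kappa> \<in> sect Names (fst U) \<Longrightarrow> snd (clk_upd U \<kappa> n) \<in> Clk (fst U)"
  by (auto simp: clk_upd_def Clk_def PiE_def extensional_def)

lemma tick_Hom:
  assumes "U \<in> Obj CLK" "\<kappa> \<in> sect Clocks U"
  shows "tick U \<kappa> \<in> Hom CLK U (clk_upd U \<kappa> (snd U \<kappa> + 1))"
proof -
  have U: "fst U \<in> Obj Fplus" "snd U \<in> Clk (fst U)" "\<kappa> \<in> sect Names (fst U)"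
    using assms by (auto simp: CLK_def Clocks_def)
  show ?thesis
    unfolding tick_def using U clk_upd_Clk[OF U(2,3)]
    by (intro CLK_HomI) (auto simp: clk_upd_def catD[OF is_category_Fplus] pshD(2)[OF is_presheaf_Names])
qed

lemma is_formula_kj_holds:
  assumes C: "is_category C" and t: "is_term C \<Gamma> (Omega C) t"
  shows "is_formula C \<Gamma> (kj_holds C t)"
  unfolding is_formula_def kj_holds_def
proof (intro allI ballI impI)
  fix V U f \<alpha> assume f: "f \<in> Hom C V U" and a: "\<alpha> \<in> sect \<Gamma> U" and m: "t U \<alpha> = maximal_sieve C U"
  have "t V (restr \<Gamma> f \<alpha>) = restr (Omega C) f (maximal_sieve C U)"
    using t f a m unfolding is_term_def by metis
  also have "\<dots> = maximal_sieve C V"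
    using catD(3)[OF C f] catD(6)[OF C f] by (auto simp: Omega_def maximal_sieve_def)
  finally show "t V (restr \<Gamma> f \<alpha>) = maximal_sieve C V" .
qed

lemma is_formula_kj_imp:
  assumes C: "is_category C" and G: "is_presheaf C \<Gamma>"
  shows "is_formula C \<Gamma> (kj_imp C \<Gamma> \<phi> \<psi>)"
  unfolding is_formula_def
proof (intro allI ballI impI)
  fix V U f \<alpha>
  assume f: "f \<in> Hom C V U" and a: "\<alpha> \<in> sect \<Gamma> U" and h: "kj_imp C \<Gamma> \<phi> \<psi> U \<alpha>"
  show "kj_imp C \<Gamma> \<phi> \<psi> V (restr \<Gamma> f \<alpha>)"
    using h catD(6)[OF C f] pshD(3)[OF G f _ a, symmetric] unfolding kj_imp_def by simp
qed

lemma is_formula_kj_all: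
  assumes C: "is_category C" and G: "is_presheaf C \<Gamma>"
  shows "is_formula C \<Gamma> (kj_all C \<Gamma> X \<psi>)"
  unfolding is_formula_def
proof (intro allI ballI impI)
  fix V U f \<alpha>
  assume f: "f \<in> Hom C V U" and a: "\<alpha> \<in> sect \<Gamma> U" and h: "kj_all C \<Gamma> X \<psi> U \<alpha>"
  show "kj_all C \<Gamma> X \<psi> V (restr \<Gamma> f \<alpha>)"
    using h catD(6)[OF C f] pshD(3)[OF G f _ a, symmetric] unfolding kj_all_def by simp
qed

lemma is_formula_later:
  assumes G: "is_presheaf CLK \<Gamma>" and k: "is_term CLK \<Gamma> Clocks k" and p: "is_formula CLK \<Gamma> \<phi>"
  shows "is_formula CLK \<Gamma> (later \<Gamma> k \<phi>)"
  unfolding is_formula_def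
proof (intro allI ballI impI)
  note F = catD[OF is_category_Fplus] and C = catD[OF is_category_CLK]
  fix V U f \<alpha>
  assume f: "f \<in> Hom CLK V U" and a: "\<alpha> \<in> sect \<Gamma> U" and l: "later \<Gamma> k \<phi> U \<alpha>"
  define \<kappa> where "\<kappa> = k U \<alpha>"
  define \<mu> where "\<mu> = restr Names (umap f) \<kappa>"
  note e = CLK_HomE[OF f]
  have kmem: "\<kappa> \<in> sect Clocks U" using k a C(2)[OF f] by (simp add: \<kappa>_def is_term_def)
  then have kN: "\<kappa> \<in> sect Names (fst U)" by (simp add: Clocks_def split_beta)
  have mN: "\<mu> \<in> sect Names (fst V)"
    unfolding \<mu>_def using pshD(1)[OF is_presheaf_Names e(2) kN] .
  have mu: "k V (restr \<Gamma> f \<alpha>) = \<mu>"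
  proof -
    have "k V (restr \<Gamma> f \<alpha>) = restr Clocks f \<kappa>"
      using k f a unfolding is_term_def \<kappa>_def by blast
    then show ?thesis by (simp add: \<mu>_def Clocks_def)
  qed
  have tick': "tick (clk_upd X \<nu> n) \<nu> \<in> Hom CLK (clk_upd X \<nu> n) X"
    if "X \<in> Obj CLK" "\<nu> \<in> sect Names (fst X)" "snd X \<nu> = n + 1" for X \<nu> n
  proof -
    have "clk_upd X \<nu> n \<in> Obj CLK"
      using that clk_upd_Clk[of X \<nu> n] by (cases X) (auto simp: CLK_def clk_upd_def)
    moreover have "clk_upd (clk_upd X \<nu> n) \<nu> (snd (clk_upd X \<nu> n) \<nu> + 1) = X"
      using that(3) by (cases X) (auto simp: clk_upd_def)
    ultimately show ?thesis
      using tick_Hom[of "clk_upd X \<nu> n" \<nu>] that(2) by (simp add: Clocks_def clk_upd_def split_beta)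
  qed
  show "later \<Gamma> k \<phi> V (restr \<Gamma> f \<alpha>)"
  proof (cases "snd V \<mu>")
    case 0
    then show ?thesis by (simp add: later_def mu)
  next
    case (Suc m)
    have le: "snd V \<mu> \<le> snd U \<kappa>" using e(5)[OF kN] by (simp add: \<mu>_def)
    with Suc l obtain n where n: "snd U \<kappa> = n + 1"
      and pn: "\<phi> (clk_upd U \<kappa> n) (restr \<Gamma> (tick (clk_upd U \<kappa> n) \<kappa>) \<alpha>)"
      by (auto simp: later_def Let_def \<kappa>_def)
    have mn: "m \<le> n" using le Suc n by simp
    define g where "g = Arrow (clk_upd V \<mu> m) (clk_upd U \<kappa> n) (umap f)"
    have g: "g \<in> Hom CLK (clk_upd V \<mu> m) (clk_upd U \<kappa> n)"
      unfolding g_def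
    proof (rule CLK_HomI)
      fix \<nu> assume nu: "\<nu> \<in> sect Names (fst (clk_upd U \<kappa> n))"
      show "snd (clk_upd V \<mu> m) (restr Names (umap f) \<nu>) \<le> snd (clk_upd U \<kappa> n) \<nu>"
        using e(5)[of \<nu>] nu mn Suc by (auto simp: clk_upd_def \<mu>_def)
    qed (use e clk_upd_Clk kN mN in \<open>auto simp: clk_upd_def\<close>)
    have tU: "tick (clk_upd U \<kappa> n) \<kappa> \<in> Hom CLK (clk_upd U \<kappa> n) U"
      using tick' C(2)[OF f] kN n by blast
    have tV: "tick (clk_upd V \<mu> m) \<mu> \<in> Hom CLK (clk_upd V \<mu> m) V"
      using tick' C(1)[OF f] mN Suc by simp
    have sq: "Comp CLK (tick (clk_upd U \<kappa> n) \<kappa>) g = Comp CLK f (tick (clk_upd V \<mu> m) \<mu>)"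
      using C(4)[OF tU] C(4)[OF f] F(7)[OF e(2)] F(8)[OF e(2)]
      by (simp add: CLK_def g_def tick_def) (simp add: clk_upd_def)
    have "\<phi> (clk_upd V \<mu> m) (restr \<Gamma> g (restr \<Gamma> (tick (clk_upd U \<kappa> n) \<kappa>) \<alpha>))"
      using p g pn pshD(1)[OF G tU a] unfolding is_formula_def by blast
    then have "\<phi> (clk_upd V \<mu> m) (restr \<Gamma> (tick (clk_upd V \<mu> m) \<mu>) (restr \<Gamma> f \<alpha>))"
      using pshD(3)[OF G tU g a] pshD(3)[OF G f tV a] sq by simp
    then show ?thesis using Suc by (simp add: later_def mu)
  qed
qed

end

theory Submission
  imports Defs
begin

text \<open>
  If \<open>\<partial>\<^sub>U(\<kappa>) = n + 1\<close>, then \<open>[\<kappa> += 1]\<close> is a morphism \<open>U[\<kappa> \<mapsto> n] \<rightarrow> U\<close>, and forcing \<open>\<triangleright>\<^sup>\<kappa> \<phi>\<close> at \<open>U\<close>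
  means forcing the restriction of \<open>\<phi>\<close> along it. So the claim is an instance of the monotonicity of
  forcing.
\<close>

lemma tick_Hom_pred:
  assumes "U \<in> Obj CLK" "\<kappa> \<in> sect Clocks U" "snd U \<kappa> = n + 1"
  shows "tick (clk_upd U \<kappa> n) \<kappa> \<in> Hom CLK (clk_upd U \<kappa> n) U"
proof -
  have "clk_upd U \<kappa> n \<in> Obj CLK" "\<kappa> \<in> sect Clocks (clk_upd U \<kappa> n)"
    using assms clk_upd_Clk[of U \<kappa> n] by (cases U; auto simp: CLK_def Clocks_def clk_upd_def)+
  \<comment> \<open>\<open>tick_Hom\<close> goes from an object to its increment. Decrementing
    \<kappa> to n and then incrementing it gives back U itself, because its value there was n +
    1.\<close>
  moreover have "clk_upd (clk_upd U \<kappa> n) \<kappa> (snd (clk_upd U \<kappa> n) \<kappa> + 1) = U"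
    using assms(3) by (cases U) (auto simp: clk_upd_def)
  ultimately show ?thesis
    using tick_Hom[of "clk_upd U \<kappa> n" \<kappa>] by simp
qed

text \<open>With no time left on the clock, \<open>later\<close> is forced outright; otherwise
  \<phi> is carried along the tick from the decremented object. This is the claim at a single
  stage.\<close>

lemma later_intro:
  assumes \<phi>: "is_formula CLK \<Gamma> \<phi>" and U: "U \<in> Obj CLK" and \<alpha>: "\<alpha> \<in> sect \<Gamma> U"
    and k: "k U \<alpha> \<in> sect Clocks U" and holds: "\<phi> U \<alpha>"
  shows "later \<Gamma> k \<phi> U \<alpha>"
proof (cases "snd U (k U \<alpha>)")
  case 0
  then show ?thesis by (simp add: later_def)
next
  case (Suc n)
  then have "tick (clk_upd U (k U \<alpha>) n) (k U \<alpha>) \<in> Hom CLK (clk_upd U (k U \<alpha>) n) U"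
    using tick_Hom_pred[OF U k] by simp
  then have "\<phi> (clk_upd U (k U \<alpha>) n) (restr \<Gamma> (tick (clk_upd U (k U \<alpha>) n) (k U \<alpha>)) \<alpha>)"
    using \<phi> \<alpha> holds unfolding is_formula_def by blast
  then show ?thesis
    using Suc by (simp add: later_def)
qed

text \<open>Implication tests every V over U, so the single-stage claim is applied at V to the
  restricted \<alpha>.\<close>

lemma kj_imp_later:
  assumes \<Gamma>: "is_presheaf CLK \<Gamma>" and k: "is_term CLK \<Gamma> Clocks k" and \<phi>: "is_formula CLK \<Gamma> \<phi>"
    and \<alpha>: "\<alpha> \<in> sect \<Gamma> U"
  shows "kj_imp CLK \<Gamma> \<phi> (later \<Gamma> k \<phi>) U \<alpha>"
  unfolding kj_imp_def
proof (intro allI ballI impI)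
  fix V f assume f: "f \<in> Hom CLK V U" and holds: "\<phi> V (restr \<Gamma> f \<alpha>)"
  have V: "V \<in> Obj CLK" and \<beta>: "restr \<Gamma> f \<alpha> \<in> sect \<Gamma> V"
    using catD(1)[OF is_category_CLK f] pshD(1)[OF \<Gamma> f \<alpha>] .
  then have "k V (restr \<Gamma> f \<alpha>) \<in> sect Clocks V"
    using k unfolding is_term_def by blast
  then show "later \<Gamma> k \<phi> V (restr \<Gamma> f \<alpha>)"
    using later_intro[OF \<phi> V \<beta>] holds by blast
qed

theorem mainTheorem4:
  "kj_valid CLK
     (kj_all CLK terminal_psh Clocks
       (kj_all CLK (terminal_psh \<times>\<^sub>P Clocks) (Omega CLK)
         (kj_imp CLK (terminal_psh \<times>\<^sub>P Clocks \<times>\<^sub>P Omega CLK)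
           (kj_holds CLK (\<lambda>U ((_, \<kappa>), \<phi>). \<phi>))
           (later (terminal_psh \<times>\<^sub>P Clocks \<times>\<^sub>P Omega CLK)
             (\<lambda>U ((_, \<kappa>), \<phi>). \<kappa>)
             (kj_holds CLK (\<lambda>U ((_, \<kappa>), \<phi>). \<phi>))))))"
proof -
  let ?\<Gamma> = "terminal_psh \<times>\<^sub>P Clocks \<times>\<^sub>P Omega CLK"
  have \<Gamma>: "is_presheaf CLK ?\<Gamma>"
    by (intro is_presheaf_prod is_presheaf_terminal is_presheaf_Clocks
        is_presheaf_Omega is_category_CLK)
  have k: "is_term CLK ?\<Gamma> Clocks (\<lambda>U ((_, \<kappa>), \<phi>). \<kappa>)"
    by (auto simp: is_term_def prod_psh_def)
  \<comment> \<open>The variable of sort \<Omega> is a natural projection, and the maximal sieve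
    pulls back to the maximal sieve.\<close>
  have \<phi>: "is_formula CLK ?\<Gamma> (kj_holds CLK (\<lambda>U ((_, \<kappa>), \<phi>). \<phi>))"
    by (rule is_formula_kj_holds[OF is_category_CLK]) (auto simp: is_term_def prod_psh_def)
  show ?thesis
    unfolding kj_valid_def kj_all_def
  proof (intro ballI allI)
    fix U V W f g \<kappa> S
    assume "\<kappa> \<in> sect Clocks V" "g \<in> Hom CLK W V" "S \<in> sect (Omega CLK) W"
    \<comment> \<open>The two quantifiers pick their values at different stages: \<kappa> at V, then
      restricted along g, and the sieve S directly at W.\<close>
    then have "(restr (terminal_psh \<times>\<^sub>P Clocks) g (restr terminal_psh f (), \<kappa>), S) \<in> sect ?\<Gamma> W"
      using pshD(1)[OF is_presheaf_Clocks] by (auto simp: prod_psh_def terminal_psh_def)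
    then show "kj_imp CLK ?\<Gamma> (kj_holds CLK (\<lambda>U ((_, \<kappa>), \<phi>). \<phi>))
        (later ?\<Gamma> (\<lambda>U ((_, \<kappa>), \<phi>). \<kappa>) (kj_holds CLK (\<lambda>U ((_, \<kappa>), \<phi>). \<phi>))) W
        (restr (terminal_psh \<times>\<^sub>P Clocks) g (restr terminal_psh f (), \<kappa>), S)"
      by (rule kj_imp_later[OF \<Gamma> k \<phi>])
  qed
qed

end
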